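(* For any integer $n\geq 1$, $$\Phi(C_{2n})=\binom{n}{2} + \left\lfloor\frac{n}{2}\right\rfloor + 1.$$
   Context: $C_m$ denotes the cycle with vertices $0,1,\dots,m-1$ and edges $\{i,i+1 \bmod m\}$. For a connected graph $G$ with vertex set $V(G)$, a path system of $G$ is a set consisting of one chosen path in $G$ connecting $a$ and $b$ for each unordered pair $\{a,b\}$ of distinct vertices. A global packing of $(G,\mathcal{P})$ is a map $\omega:\mathcal{P}\to\{1,\dots,k\}$ such that $\omega(P)\neq\omega(P')$ whenever distinct paths $P,P'\in\mathcal{P}$ share at least one edge; $\Phi(G,\mathcal{P})$ is the minimum such $k$, and $\Phi(G)$ is the minimum of $\Phi(G,\mathcal{P})$ over all path systems $\mathcal{P}$ of $G$. *)

theory Defs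
  imports Complex_Main
begin

text \<open>Undirected graphs; an edge is the set of its end vertices.\<close>

record 'a ugraph =
  verts :: "'a set"
  edges :: "'a set set"

definition cycle_graph :: "nat \<Rightarrow> nat ugraph" where
  "cycle_graph m = \<lparr>verts = {..<m}, edges = {{i, (i + 1) mod m} | i. i < m}\<rparr>"

text \<open>
  A path is a subgraph rather than a vertex sequence, so a sequence and its reversal describe the
  same path, and \<open>connects G P a b\<close> is symmetric in \<open>a\<close> and \<open>b\<close>.
\<close>

definition path_graph :: "'a list \<Rightarrow> 'a ugraph" where
  "path_graph vs = \<lparr>verts = set vs, edges = {{vs ! i, vs ! (i + 1)} | i. i + 1 < length vs}\<rparr>"

definition connects :: "'a ugraph \<Rightarrow> 'a ugraph \<Rightarrow> 'a \<Rightarrow> 'a \<Rightarrow> bool" where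
  "connects G P a b \<longleftrightarrow>
     (\<exists>vs. vs \<noteq> [] \<and> distinct vs \<and> hd vs = a \<and> last vs = b \<and> P = path_graph vs) \<and>
     verts P \<subseteq> verts G \<and> edges P \<subseteq> edges G"

definition path_system :: "'a ugraph \<Rightarrow> 'a ugraph set \<Rightarrow> bool" where
  "path_system G \<P> \<longleftrightarrow>
     (\<forall>P\<in>\<P>. \<exists>a\<in>verts G. \<exists>b\<in>verts G. a \<noteq> b \<and> connects G P a b) \<and>
     (\<forall>a\<in>verts G. \<forall>b\<in>verts G. a \<noteq> b \<longrightarrow> (\<exists>!P. P \<in> \<P> \<and> connects G P a b))"

definition global_packing :: "'a ugraph set \<Rightarrow> nat \<Rightarrow> ('a ugraph \<Rightarrow> nat) \<Rightarrow> bool" where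
  "global_packing \<P> k \<omega> \<longleftrightarrow>
     (\<forall>P\<in>\<P>. \<omega> P \<in> {1..k}) \<and>
     (\<forall>P\<in>\<P>. \<forall>P'\<in>\<P>. P \<noteq> P' \<and> edges P \<inter> edges P' \<noteq> {} \<longrightarrow> \<omega> P \<noteq> \<omega> P')"

text \<open>
  Sharing an edge depends only on the paths, so the ambient graph is not an argument here.
  For a finite connected graph both minima below are attained.
\<close>

definition Phi_system :: "'a ugraph set \<Rightarrow> nat" where
  "Phi_system \<P> = (LEAST k. \<exists>\<omega>. global_packing \<P> k \<omega>)"

definition Phi :: "'a ugraph \<Rightarrow> nat" where
  "Phi G = (LEAST k. \<exists>\<P>. path_system G \<P> \<and> k = Phi_system \<P>)"

end

theory Submission
  imports Defs
begin

text \<open>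
  Lower bound: the antipodal edges \<open>i\<close> and \<open>i + n\<close> cut the cycle into two halves of \<open>n\<close>
  vertices, so together they carry at least \<open>n\<^sup>2\<close> paths, while a packing with \<open>k\<close> colours allows
  at most \<open>k\<close> paths on each edge; hence \<open>n\<^sup>2 \<le> 2 * k\<close>. For even \<open>n\<close>, equality would force all
  edges to carry the same number of paths. But every path system uses the edges of a cut
  \<open>A, V - A\<close> a number of times that has the parity of \<open>card A * card (V - A)\<close>. For a single
  vertex of the cycle this number is \<open>2 * n - 1\<close>, so adjacent edges carry different numbers of
  paths.

  Upper bound: take shortest paths. It suffices to cover them by sets of arcs that follow one
  another without going more than once around the cycle. For \<open>1 < l < n - 1\<close> use the tilings by
  arcs of lengths \<open>l, n - l, l, n - l\<close>. Each is obtained both from \<open>l\<close> and from \<open>n - l\<close>, so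
  there are at most \<open>n * (n - 3) / 2\<close> of them. Each of the \<open>n\<close> arcs of length \<open>n\<close> is followed by
  one of length \<open>n - 1\<close>. The arc of length \<open>n\<close> for an antipodal pair is chosen in such a way that
  \<open>n div 2 + 1\<close> further sets suffice for the other arcs of lengths \<open>1\<close> and \<open>n - 1\<close>.
\<close>

section \<open>Edge cuts\<close>

definition edge_cut :: "'a ugraph \<Rightarrow> 'a set \<Rightarrow> 'a set set" where
  "edge_cut G A = {e \<in> edges G. e \<inter> A \<noteq> {} \<and> e - A \<noteq> {}}"

lemma edge_cut_of_subgraph:
  assumes "edges P \<subseteq> edges G"
  shows "edge_cut P A = edges P \<inter> edge_cut G A"
  using assms by (auto simp: edge_cut_def)

lemma edges_path_graph_singleton: "edges (path_graph [x]) = {}"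
  by (simp add: path_graph_def)

lemma edges_path_graph_Cons:
  "edges (path_graph (x # y # zs)) = insert {x, y} (edges (path_graph (y # zs)))"
proof -
  let ?vs = "x # y # zs" and ?ws = "y # zs"
  have "{i. i + 1 < length ?vs} = insert 0 (Suc ` {i. i + 1 < length ?ws})"
    by (auto simp: less_Suc_eq_0_disj image_iff)
  then have "(\<lambda>i. {?vs ! i, ?vs ! (i + 1)}) ` {i. i + 1 < length ?vs} =
      insert {x, y} ((\<lambda>i. {?ws ! i, ?ws ! (i + 1)}) ` {i. i + 1 < length ?ws})"
    by (simp add: image_image)
  then show ?thesis
    by (simp add: path_graph_def setcompr_eq_image)
qed

lemma edges_path_graph_subset: "e \<in> edges (path_graph vs) \<Longrightarrow> e \<subseteq> set vs"
  by (auto simp: path_graph_def)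

lemma finite_edges_path_graph: "finite (edges (path_graph vs))"
  by (rule finite_subset[of _ "Pow (set vs)"]) (auto dest: edges_path_graph_subset)

lemma odd_card_edge_cut_path_graph:
  assumes "vs \<noteq> []" "distinct vs"
  shows "odd (card (edge_cut (path_graph vs) A)) \<longleftrightarrow> (hd vs \<in> A) \<noteq> (last vs \<in> A)"
  using assms
proof (induction vs rule: induct_list012)
  case 1
  then show ?case by simp
next
  case (2 x)
  then show ?case by (simp add: edge_cut_def edges_path_graph_singleton)
next
  case (3 x y zs)
  let ?C = "edge_cut (path_graph (y # zs)) A"
  have IH: "odd (card ?C) \<longleftrightarrow> (y \<in> A) \<noteq> (last (y # zs) \<in> A)"
    using 3 by simp
  have "finite ?C"
    by (simp add: edge_cut_def finite_edges_path_graph)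
  moreover have "{x, y} \<notin> ?C"
    using edges_path_graph_subset[of "{x, y}" "y # zs"] 3 by (auto simp: edge_cut_def)
  moreover have "edge_cut (path_graph (x # y # zs)) A =
      (if (x \<in> A) \<noteq> (y \<in> A) then insert {x, y} ?C else ?C)"
    by (auto simp: edge_cut_def edges_path_graph_Cons)
  ultimately show ?case
    using IH by auto
qed

lemma connects_odd_card_edge_cut:
  assumes "connects G P a b"
  shows "odd (card (edge_cut P A)) \<longleftrightarrow> (a \<in> A) \<noteq> (b \<in> A)"
  using assms odd_card_edge_cut_path_graph by (auto simp: connects_def)

section \<open>Path systems\<close>

definition path_ends :: "'a ugraph \<Rightarrow> 'a set" where
  "path_ends P = {v. odd (card (edge_cut P {v}))}"

lemma connects_path_ends:
  assumes "connects G P a b" "a \<noteq> b"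
  shows "path_ends P = {a, b}"
  using assms by (auto simp: path_ends_def connects_odd_card_edge_cut)

lemma path_graph_rev: "path_graph (rev vs) = path_graph vs"
proof -
  have edges_rev: "edges (path_graph (rev ws)) \<subseteq> edges (path_graph ws)" for ws :: "'a list"
  proof
    fix e assume "e \<in> edges (path_graph (rev ws))"
    then obtain i where e: "e = {rev ws ! i, rev ws ! (i + 1)}" "i + 1 < length ws"
      by (auto simp: path_graph_def)
    define j where "j = length ws - 2 - i"
    have "rev ws ! i = ws ! (j + 1)" "rev ws ! (i + 1) = ws ! j" "j + 1 < length ws"
      using e by (auto simp: rev_nth j_def Suc_diff_Suc numeral_2_eq_2)
    then show "e \<in> edges (path_graph ws)"
      using e by (auto simp: path_graph_def insert_commute)
  qed
  show ?thesis
    using edges_rev[of vs] edges_rev[of "rev vs"] by (simp add: path_graph_def)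
qed

lemma connects_sym: "connects G P a b \<Longrightarrow> connects G P b a"
  unfolding connects_def
  by (metis distinct_rev hd_rev last_rev path_graph_rev rev_is_Nil_conv)

lemma path_systemE:
  assumes "path_system G \<P>" "P \<in> \<P>"
  obtains a b where "a \<in> verts G" "b \<in> verts G" "a \<noteq> b" "connects G P a b"
  using assms by (auto simp: path_system_def)

lemma path_system_obtain_path:
  assumes "path_system G \<P>" "a \<in> verts G" "b \<in> verts G" "a \<noteq> b"
  obtains P where "P \<in> \<P>" "connects G P a b"
  using assms unfolding path_system_def by metis

lemma inj_on_path_ends:
  assumes "path_system G \<P>"
  shows "inj_on path_ends \<P>"
proof (rule inj_onI)
  fix P Q assume same_ends: "P \<in> \<P>" "Q \<in> \<P>" "path_ends P = path_ends Q"
  obtain a b where ends_P: "a \<in> verts G" "b \<in> verts G" "a \<noteq> b" "connects G P a b"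
    using path_systemE[OF assms same_ends(1)] .
  obtain a' b' where ends_Q: "a' \<noteq> b'" "connects G Q a' b'"
    using path_systemE[OF assms same_ends(2)] .
  have "{a, b} = {a', b'}"
    using same_ends(3) ends_P ends_Q by (simp add: connects_path_ends)
  then have "connects G Q a b"
    using ends_Q connects_sym by (auto simp: doubleton_eq_iff)
  then show "P = Q"
    using assms same_ends ends_P unfolding path_system_def by blast
qed

lemma finite_path_system:
  assumes "path_system G \<P>" "finite (verts G)"
  shows "finite \<P>"
proof (rule inj_on_finite[OF inj_on_path_ends[OF assms(1)]])
  show "path_ends ` \<P> \<subseteq> Pow (verts G)"
  proof (rule image_subsetI)
    fix P assume "P \<in> \<P>"
    then obtain a b where "a \<in> verts G" "b \<in> verts G" "a \<noteq> b" "connects G P a b"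
      using path_systemE[OF assms(1)] by blast
    then show "path_ends P \<in> Pow (verts G)"
      by (simp add: connects_path_ends)
  qed
qed (use assms in simp)

lemma path_ends_image_separating_paths:
  assumes "path_system G \<P>" "A \<subseteq> verts G"
  shows "path_ends ` {P \<in> \<P>. odd (card (edge_cut P A))} =
    (\<lambda>(a, b). {a, b}) ` (A \<times> (verts G - A))"
proof (intro equalityI subsetI)
  fix X assume "X \<in> path_ends ` {P \<in> \<P>. odd (card (edge_cut P A))}"
  then obtain P where P: "P \<in> \<P>" "odd (card (edge_cut P A))" and X: "X = path_ends P"
    by blast
  obtain a b where ends: "a \<in> verts G" "b \<in> verts G" "a \<noteq> b" "connects G P a b"
    using path_systemE[OF assms(1) P(1)] .
  then have "(a \<in> A) \<noteq> (b \<in> A)"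
    using P(2) connects_odd_card_edge_cut by metis
  moreover have "X = {a, b}"
    using X ends connects_path_ends by metis
  ultimately show "X \<in> (\<lambda>(a, b). {a, b}) ` (A \<times> (verts G - A))"
    using ends by (auto simp: image_iff insert_commute)
next
  fix X assume "X \<in> (\<lambda>(a, b). {a, b}) ` (A \<times> (verts G - A))"
  then obtain a b where ends: "a \<in> A" "b \<in> verts G - A" "X = {a, b}"
    by auto
  then obtain P where P: "P \<in> \<P>" "connects G P a b"
    using path_system_obtain_path[OF assms(1), of a b] assms(2) by blast
  moreover have "odd (card (edge_cut P A))"
    using P(2) ends by (simp add: connects_odd_card_edge_cut)
  moreover have "X = path_ends P"
    using connects_path_ends[OF P(2)] ends by auto
  ultimately show "X \<in> path_ends ` {P \<in> \<P>. odd (card (edge_cut P A))}"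
    by blast
qed

lemma card_separating_paths:
  assumes "path_system G \<P>" "A \<subseteq> verts G"
  shows "card {P \<in> \<P>. odd (card (edge_cut P A))} = card A * card (verts G - A)"
proof -
  have "card {P \<in> \<P>. odd (card (edge_cut P A))} =
      card (path_ends ` {P \<in> \<P>. odd (card (edge_cut P A))})"
    by (intro card_image[symmetric] inj_on_subset[OF inj_on_path_ends[OF assms(1)]]) auto
  also have "\<dots> = card ((\<lambda>(a, b). {a, b}) ` (A \<times> (verts G - A)))"
    by (simp add: path_ends_image_separating_paths[OF assms])
  also have "\<dots> = card (A \<times> (verts G - A))"
    by (intro card_image) (auto simp: inj_on_def doubleton_eq_iff)
  finally show ?thesis
    by (simp add: card_cartesian_product)
qed

lemma path_system_of_ordered_pairs:
  fixes G :: "'a :: linorder ugraph"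
  assumes "\<And>a b. a \<in> verts G \<Longrightarrow> b \<in> verts G \<Longrightarrow> a < b \<Longrightarrow> connects G (p a b) a b"
  shows "path_system G {p a b | a b. a \<in> verts G \<and> b \<in> verts G \<and> a < b}" (is "path_system G ?\<P>")
  unfolding path_system_def
proof (intro conjI ballI impI)
  fix P assume "P \<in> ?\<P>"
  then obtain a b where "a \<in> verts G" "b \<in> verts G" "a < b" "connects G P a b"
    using assms by blast
  then show "\<exists>a\<in>verts G. \<exists>b\<in>verts G. a \<noteq> b \<and> connects G P a b"
    by (metis less_irrefl)
next
  have unique: "\<exists>!P. P \<in> ?\<P> \<and> connects G P a b"
    if ends: "a \<in> verts G" "b \<in> verts G" "a < b" for a b
  proof (intro ex1I[of _ "p a b"] conjI)
    fix P assume P: "P \<in> ?\<P> \<and> connects G P a b"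
    then obtain a' b' where P_ends: "P = p a' b'" "a' < b'" "connects G P a' b'"
      using assms by blast
    then have "{a, b} = {a', b'}"
      using P ends connects_path_ends[of G P a b] connects_path_ends[of G P a' b'] by simp
    then show "P = p a b"
      using ends P_ends by (auto simp: doubleton_eq_iff)
  qed (use ends assms in auto)
  fix a b assume ends: "a \<in> verts G" "b \<in> verts G" "a \<noteq> b"
  have "connects G P b a = connects G P a b" for P
    using connects_sym[of G P a b] connects_sym[of G P b a] by (rule iffI[rotated])
  then show "\<exists>!P. P \<in> ?\<P> \<and> connects G P a b"
    using unique[of a b] unique[of b a] ends by (cases "a < b") auto
qed

section \<open>Loads\<close>

definition load :: "'a ugraph set \<Rightarrow> 'a set \<Rightarrow> nat" where
  "load \<P> e = card {P \<in> \<P>. e \<in> edges P}"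

lemma load_le_of_global_packing:
  assumes "global_packing \<P> k \<omega>"
  shows "load \<P> e \<le> k"
proof -
  have "inj_on \<omega> {P \<in> \<P>. e \<in> edges P}" "\<omega> ` {P \<in> \<P>. e \<in> edges P} \<subseteq> {1..k}"
    using assms by (auto simp: inj_on_def global_packing_def)
  then show ?thesis
    using card_inj_on_le[of \<omega> _ "{1..k}"] by (simp add: load_def)
qed

lemma sum_load:
  assumes "finite \<P>" "finite F"
  shows "(\<Sum>e\<in>F. load \<P> e) = (\<Sum>P\<in>\<P>. card (edges P \<inter> F))"
  unfolding load_def using assms by (intro sum_multicount_gen) (auto simp: Int_def conj_commute)

lemma sum_load_edge_cut:
  assumes "path_system G \<P>" "finite (verts G)" "finite (edges G)"
  shows "(\<Sum>e\<in>edge_cut G A. load \<P> e) = (\<Sum>P\<in>\<P>. card (edge_cut P A))"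
proof -
  have "edge_cut P A = edges P \<inter> edge_cut G A" if "P \<in> \<P>" for P
    using path_systemE[OF assms(1) that] edge_cut_of_subgraph unfolding connects_def by metis
  moreover have "finite (edge_cut G A)"
    using assms(3) by (simp add: edge_cut_def)
  ultimately show ?thesis
    using finite_path_system[OF assms(1,2)] by (simp add: sum_load)
qed

lemma even_sum_load_edge_cut_iff:
  assumes "path_system G \<P>" "finite (verts G)" "finite (edges G)" "A \<subseteq> verts G"
  shows "even (\<Sum>e\<in>edge_cut G A. load \<P> e) \<longleftrightarrow> even (card A * card (verts G - A))"
  using finite_path_system[OF assms(1,2)]
  by (simp add: sum_load_edge_cut[OF assms(1-3)] even_sum_iff card_separating_paths[OF assms(1,4)])

lemma sum_load_edge_cut_ge:
  assumes "path_system G \<P>" "finite (verts G)" "finite (edges G)" "A \<subseteq> verts G"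
  shows "card A * card (verts G - A) \<le> (\<Sum>e\<in>edge_cut G A. load \<P> e)"
proof -
  let ?S = "{P \<in> \<P>. odd (card (edge_cut P A))}"
  have "card A * card (verts G - A) = (\<Sum>P\<in>?S. 1)"
    using card_separating_paths[OF assms(1,4)] by simp
  also have "\<dots> \<le> (\<Sum>P\<in>?S. card (edge_cut P A))"
    by (intro sum_mono) (auto elim: oddE)
  also have "\<dots> \<le> (\<Sum>P\<in>\<P>. card (edge_cut P A))"
    using finite_path_system[OF assms(1,2)] by (intro sum_mono2) auto
  finally show ?thesis
    by (simp add: sum_load_edge_cut[OF assms(1-3)])
qed

section \<open>Packings from covers by edge-disjoint sets\<close>

definition edge_disjoint :: "'a ugraph set \<Rightarrow> bool" where
  "edge_disjoint \<A> \<longleftrightarrow> pairwise (\<lambda>P Q. disjnt (edges P) (edges Q)) \<A>"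

lemma edge_disjoint_singleton: "edge_disjoint {P}"
  by (simp add: edge_disjoint_def)

lemma global_packing_of_cover:
  assumes "finite \<C>" "card \<C> \<le> k" "\<And>\<A>. \<A> \<in> \<C> \<Longrightarrow> edge_disjoint \<A>" "\<P> \<subseteq> \<Union>\<C>"
  shows "\<exists>\<omega>. global_packing \<P> k \<omega>"
proof -
  obtain g where bij: "bij_betw g \<C> {1..card \<C>}"
    using assms(1) finite_same_card_bij[of \<C> "{1..card \<C>}"] by auto
  have "\<forall>P\<in>\<P>. \<exists>\<A>\<in>\<C>. P \<in> \<A>"
    using assms(4) by blast
  then obtain \<A> where \<A>: "\<forall>P\<in>\<P>. \<A> P \<in> \<C>" "\<forall>P\<in>\<P>. P \<in> \<A> P"
    by metis
  have "global_packing \<P> k (g \<circ> \<A>)"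
    unfolding global_packing_def
  proof (intro conjI ballI impI)
    fix P assume "P \<in> \<P>"
    then have "g (\<A> P) \<in> {1..card \<C>}"
      using bij \<A>(1) bij_betwE by blast
    then show "(g \<circ> \<A>) P \<in> {1..k}"
      using assms(2) by simp
  next
    fix P Q assume meet: "P \<in> \<P>" "Q \<in> \<P>" "P \<noteq> Q \<and> edges P \<inter> edges Q \<noteq> {}"
    have "edge_disjoint (\<A> P)"
      using assms(3) \<A>(1) meet(1) by blast
    then have "\<A> P \<noteq> \<A> Q"
      using meet \<A>(2) by (auto simp: edge_disjoint_def pairwise_def disjnt_def)
    then show "(g \<circ> \<A>) P \<noteq> (g \<circ> \<A>) Q"
      using meet bij \<A>(1) by (auto simp: bij_betw_def inj_on_def)
  qed
  then show ?thesis
    by blast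
qed

lemma ex_global_packing:
  assumes "finite \<P>"
  shows "\<exists>\<omega>. global_packing \<P> (card \<P>) \<omega>"
proof (rule global_packing_of_cover)
  show "card ((\<lambda>P. {P}) ` \<P>) \<le> card \<P>"
    using assms by (rule card_image_le)
qed (use assms edge_disjoint_singleton in auto)

lemma Phi_eqI:
  assumes finite_verts: "finite (verts G)"
    and system: "path_system G \<P>" and packing: "global_packing \<P> k \<omega>"
    and lower: "\<And>\<P> j \<omega>. path_system G \<P> \<Longrightarrow> global_packing \<P> j \<omega> \<Longrightarrow> k \<le> j"
  shows "Phi G = k"
proof -
  have Phi_system_ge: "k \<le> Phi_system \<Q>" if "path_system G \<Q>" for \<Q>
  proof -
    have "\<exists>j. \<exists>\<omega>. global_packing \<Q> j \<omega>"
      using ex_global_packing[OF finite_path_system[OF that finite_verts]] ..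
    then have "\<exists>\<omega>. global_packing \<Q> (Phi_system \<Q>) \<omega>"
      unfolding Phi_system_def by (rule LeastI_ex)
    then show ?thesis
      using lower that by blast
  qed
  have "Phi_system \<P> \<le> k"
    unfolding Phi_system_def using packing by (blast intro: Least_le)
  then have "Phi_system \<P> = k"
    using Phi_system_ge[OF system] by simp
  then show ?thesis
    unfolding Phi_def using system Phi_system_ge by (intro Least_equality) auto
qed

section \<open>Cycles\<close>

definition cycle_edge :: "nat \<Rightarrow> nat \<Rightarrow> nat set" where
  "cycle_edge m i = {i mod m, Suc i mod m}"

lemma verts_cycle_graph: "verts (cycle_graph m) = {..<m}"
  by (simp add: cycle_graph_def)

lemma edges_cycle_graph: "edges (cycle_graph m) = cycle_edge m ` {..<m}"
  by (auto simp: cycle_graph_def cycle_edge_def)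

lemma cycle_edge_mod: "cycle_edge m (i mod m) = cycle_edge m i"
  by (simp add: cycle_edge_def mod_Suc_eq)

lemma cycle_edge_in_edges:
  assumes "0 < m"
  shows "cycle_edge m i \<in> edges (cycle_graph m)"
proof -
  have "cycle_edge m (i mod m) \<in> edges (cycle_graph m)"
    using assms by (simp add: edges_cycle_graph)
  then show ?thesis
    by (simp only: cycle_edge_mod)
qed

lemma cycle_edge_eq_iff:
  assumes "3 \<le> m"
  shows "cycle_edge m i = cycle_edge m j \<longleftrightarrow> i mod m = j mod m"
proof
  assume eq: "cycle_edge m i = cycle_edge m j"
  have "i mod m < m" "j mod m < m"
    using assms by simp_all
  then show "i mod m = j mod m"
    using eq assms by (auto simp: cycle_edge_def doubleton_eq_iff mod_Suc split: if_splits)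
qed (metis cycle_edge_mod)

lemma edge_cut_cycle_graph_interval:
  assumes "i < j" "j < m"
  shows "edge_cut (cycle_graph m) {i<..j} = {cycle_edge m i, cycle_edge m j}"
proof -
  have "cycle_edge m k \<in> edge_cut (cycle_graph m) {i<..j} \<longleftrightarrow> k = i \<or> k = j" if "k < m" for k
    using that assms cycle_edge_in_edges[of m k]
    by (auto simp: edge_cut_def cycle_edge_def mod_Suc split: if_splits)
  moreover have "edge_cut (cycle_graph m) {i<..j} \<subseteq> cycle_edge m ` {..<m}"
    by (auto simp: edge_cut_def edges_cycle_graph)
  ultimately show ?thesis
    using assms by fastforce
qed

lemma card_verts_cycle_graph_Diff_interval:
  assumes "j < m"
  shows "card (verts (cycle_graph m) - {i<..j}) = m - (j - i)"
  using assms by (subst card_Diff_subset) (auto simp: verts_cycle_graph)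

lemma cycle_load_add_ge:
  assumes "path_system (cycle_graph m) \<P>" "i < j" "j < m"
  shows "(j - i) * (m - (j - i)) \<le> load \<P> (cycle_edge m i) + load \<P> (cycle_edge m j)"
proof -
  have "finite (verts (cycle_graph m))" "finite (edges (cycle_graph m))"
    "{i<..j} \<subseteq> verts (cycle_graph m)"
    using assms(3) by (auto simp: verts_cycle_graph edges_cycle_graph)
  then have "(j - i) * (m - (j - i)) \<le> (\<Sum>e\<in>{cycle_edge m i, cycle_edge m j}. load \<P> e)"
    using sum_load_edge_cut_ge[OF assms(1)] edge_cut_cycle_graph_interval[OF assms(2,3)]
      card_verts_cycle_graph_Diff_interval[OF assms(3)] by (metis card_greaterThanAtMost)
  then show ?thesis
    by (cases "cycle_edge m i = cycle_edge m j") auto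
qed

lemma even_cycle_load_add_iff:
  assumes "path_system (cycle_graph m) \<P>" "i < j" "j < m" "3 \<le> m"
  shows "even (load \<P> (cycle_edge m i) + load \<P> (cycle_edge m j)) \<longleftrightarrow>
    even ((j - i) * (m - (j - i)))"
proof -
  have "cycle_edge m i \<noteq> cycle_edge m j"
    using assms by (simp add: cycle_edge_eq_iff)
  then have "load \<P> (cycle_edge m i) + load \<P> (cycle_edge m j) =
      (\<Sum>e\<in>edge_cut (cycle_graph m) {i<..j}. load \<P> e)"
    using assms by (simp add: edge_cut_cycle_graph_interval)
  moreover have "finite (verts (cycle_graph m))" "finite (edges (cycle_graph m))"
    "{i<..j} \<subseteq> verts (cycle_graph m)"
    using assms(3) by (auto simp: verts_cycle_graph edges_cycle_graph)
  ultimately show ?thesis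
    using even_sum_load_edge_cut_iff[OF assms(1)]
      card_verts_cycle_graph_Diff_interval[OF assms(3)] by (metis card_greaterThanAtMost)
qed

lemma double_choose_two: "2 * (n choose 2) + n = n * n"
  by (cases n) (simp_all add: choose_two)

lemma cycle_packing_lower_bound:
  assumes "n \<ge> 1" and system: "path_system (cycle_graph (2 * n)) \<P>"
    and packing: "global_packing \<P> k \<omega>"
  shows "(n choose 2) + n div 2 + 1 \<le> k"
proof (rule ccontr)
  assume "\<not> ?thesis"
  then have small: "2 * k \<le> 2 * (n choose 2) + 2 * (n div 2)"
    by simp
  let ?L = "\<lambda>i. load \<P> (cycle_edge (2 * n) i)"
  have load_le: "?L i \<le> k" for i
    using load_le_of_global_packing[OF packing] .
  have cut_load_ge: "2 * (n choose 2) + n \<le> ?L i + ?L (i + n)" if "i < n" for i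
    using cycle_load_add_ge[OF system, of i "i + n"] that by (simp add: double_choose_two)
  have "even n"
  proof (rule ccontr)
    assume "odd n"
    then have "2 * (n div 2) < n"
      by presburger
    then show False
      using cut_load_ge[of 0] load_le[of 0] load_le[of n] small \<open>n \<ge> 1\<close> by simp
  qed
  then have "n \<ge> 2"
    using \<open>n \<ge> 1\<close> by (auto elim!: evenE)
  have "?L 0 = k" "?L 1 = k"
    using cut_load_ge[of 0] load_le[of 0] load_le[of n]
      cut_load_ge[of 1] load_le[of 1] load_le[of "1 + n"] small \<open>n \<ge> 2\<close> \<open>even n\<close>
    by auto
  then have "even (?L 0 + ?L 1)"
    by simp
  then show False
    using even_cycle_load_add_iff[OF system, of 0 1] \<open>n \<ge> 2\<close> by simp
qed

section \<open>Arcs and tilings\<close>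

definition arc :: "nat \<Rightarrow> nat \<Rightarrow> nat \<Rightarrow> nat ugraph" where
  "arc m s l = path_graph (map (\<lambda>i. (s + i) mod m) [0..<Suc l])"

lemma edges_path_graph_map_upt:
  "edges (path_graph (map f [0..<Suc l])) = (\<lambda>i. {f i, f (Suc i)}) ` {..<l}"
proof -
  let ?vs = "map f [0..<Suc l]"
  have "?vs ! i = f i" if "i \<le> l" for i
    using that nth_map[of i "[0..<Suc l]" f] by (simp del: upt_Suc)
  then have "(\<lambda>i. {?vs ! i, ?vs ! (i + 1)}) ` {..<l} = (\<lambda>i. {f i, f (Suc i)}) ` {..<l}"
    by (intro image_cong) (simp_all del: upt_Suc)
  moreover have "{i. i + 1 < length ?vs} = {..<l}"
    by auto
  ultimately show ?thesis
    by (simp add: path_graph_def setcompr_eq_image del: upt_Suc)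
qed

lemma edges_arc: "edges (arc m s l) = cycle_edge m ` {s..<s + l}"
proof -
  have "edges (arc m s l) = cycle_edge m ` (+) s ` {..<l}"
    by (simp add: arc_def edges_path_graph_map_upt cycle_edge_def image_image del: upt_Suc)
  also have "(+) s ` {..<l} = {s..<s + l}"
    by (simp add: lessThan_atLeast0 add.commute)
  finally show ?thesis .
qed

lemma arc_mod: "arc m (s mod m) l = arc m s l"
  by (simp add: arc_def mod_add_left_eq)

lemma arc_cong: "s mod m = s' mod m \<Longrightarrow> arc m s l = arc m s' l"
  by (metis arc_mod)

lemma inj_on_mod_interval: "inj_on (\<lambda>i. i mod m) {s..<s + m :: nat}"
proof (rule linorder_inj_onI')
  fix i j assume "i \<in> {s..<s + m}" "j \<in> {s..<s + m}" "i < j"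
  then have "\<not> m dvd j - i"
    by (intro nat_dvd_not_less) auto
  then show "i mod m \<noteq> j mod m"
    using mod_eq_dvd_iff_nat[of i j m] \<open>i < j\<close> by auto
qed

lemma connects_arc:
  assumes "l < m"
  shows "connects (cycle_graph m) (arc m s l) (s mod m) ((s + l) mod m)"
  unfolding connects_def
proof (intro conjI exI[of _ "map (\<lambda>i. (s + i) mod m) [0..<Suc l]"])
  have "(+) s ` {0..<Suc l} \<subseteq> {s..<s + m}"
    using assms by auto
  then have "inj_on (\<lambda>i. i mod m) ((+) s ` {0..<Suc l})"
    by (rule inj_on_subset[OF inj_on_mod_interval])
  then have "inj_on ((\<lambda>i. i mod m) \<circ> (+) s) {0..<Suc l}"
    by (intro comp_inj_on) simp_all
  then show "distinct (map (\<lambda>i. (s + i) mod m) [0..<Suc l])"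
    by (simp add: distinct_map comp_def del: upt_Suc)
  show "verts (arc m s l) \<subseteq> verts (cycle_graph m)"
    using assms by (auto simp: arc_def path_graph_def verts_cycle_graph)
  show "edges (arc m s l) \<subseteq> edges (cycle_graph m)"
    using assms cycle_edge_in_edges by (auto simp: edges_arc)
qed (auto simp: hd_map last_map arc_def simp del: upt_Suc)

fun tiling :: "nat \<Rightarrow> nat \<Rightarrow> nat list \<Rightarrow> nat ugraph set" where
  "tiling m s [] = {}"
| "tiling m s (l # ls) = insert (arc m s l) (tiling m (s + l) ls)"

lemma edges_tiling_subset:
  assumes "P \<in> tiling m s ls"
  shows "edges P \<subseteq> cycle_edge m ` {s..<s + sum_list ls}"
  using assms
proof (induction ls arbitrary: s)
  case (Cons l ls)
  show ?case
  proof (cases "P = arc m s l")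
    case True
    then show ?thesis by (auto simp: edges_arc)
  next
    case False
    then have "edges P \<subseteq> cycle_edge m ` {s + l..<s + l + sum_list ls}"
      using Cons by simp
    then show ?thesis by fastforce
  qed
qed simp

lemma edge_disjoint_tiling:
  assumes "3 \<le> m" "sum_list ls \<le> m"
  shows "edge_disjoint (tiling m s ls)"
  using assms(2)
proof (induction ls arbitrary: s)
  case Nil
  then show ?case by (simp add: edge_disjoint_def)
next
  case (Cons l ls)
  have inj_cycle_edge: "inj_on (cycle_edge m) {s..<s + m}"
    using inj_on_mod_interval[of m s] assms(1) by (simp add: inj_on_def cycle_edge_eq_iff)
  have "disjnt (edges (arc m s l)) (edges P)" if "P \<in> tiling m (s + l) ls" for P
  proof -
    have "cycle_edge m ` {s..<s + l} \<inter> cycle_edge m ` {s + l..<s + l + sum_list ls} =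
        cycle_edge m ` ({s..<s + l} \<inter> {s + l..<s + l + sum_list ls})"
      using Cons.prems by (intro inj_on_image_Int[OF inj_cycle_edge, symmetric]) auto
    also have "\<dots> = {}"
      by auto
    finally show ?thesis
      using edges_tiling_subset[OF that] by (auto simp: disjnt_def edges_arc)
  qed
  then show ?case
    using Cons by (auto simp: edge_disjoint_def pairwise_insert disjnt_sym)
qed

lemma tiling_append: "tiling m s (ks @ ls) = tiling m s ks \<union> tiling m (s + sum_list ks) ls"
  by (induction ks arbitrary: s) (simp_all add: add.assoc)

lemma tiling_cong: "s mod m = s' mod m \<Longrightarrow> tiling m s ls = tiling m s' ls"
proof (induction ls arbitrary: s s')
  case (Cons l ls)
  then show ?case
    using arc_cong[of s m s' l] Cons.IH[of "s + l" "s' + l"] by (metis mod_add_cong tiling.simps(2))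
qed simp

lemma tiling_rotate:
  assumes "sum_list ks + sum_list ls = m"
  shows "tiling m (s + sum_list ks) (ls @ ks) = tiling m s (ks @ ls)"
proof -
  have "tiling m (s + sum_list ks + sum_list ls) ks = tiling m s ks"
    by (rule tiling_cong) (simp add: add.assoc assms)
  then show ?thesis
    by (auto simp: tiling_append)
qed

lemma tiling_double_mod:
  assumes "sum_list ls = n"
  shows "tiling (2 * n) (s mod n) (ls @ ls) = tiling (2 * n) s (ls @ ls)"
proof -
  have "tiling (2 * n) (s mod n + k * n) (ls @ ls) = tiling (2 * n) (s mod n) (ls @ ls)" for k
  proof (induction k)
    case (Suc k)
    then show ?case
      using tiling_rotate[of ls ls "2 * n" "s mod n + k * n"] assms by (simp add: algebra_simps)
  qed simp
  from this[of "s div n"] show ?thesis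
    by simp
qed

lemma tiling_units: "tiling m s (replicate k 1) = (\<lambda>i. arc m i 1) ` {s..<s + k}"
proof (induction k arbitrary: s)
  case (Suc k)
  have "{s..<s + Suc k} = insert s {s + 1..<s + 1 + k}"
    by auto
  then show ?case
    using Suc[of "s + 1"] by simp
qed simp

section \<open>Shortest paths in even cycles\<close>

text \<open>
  With starts alternating between the two sides of the cycle, the points not antipodal to a start
  form the pairs \<open>2 * y, 2 * y + 1 + n\<close>, except for the point \<open>n - 1\<close> when \<open>n\<close> is odd. The arcs of
  length \<open>n - 1\<close> from such a pair are disjoint.
\<close>

definition diam_start :: "nat \<Rightarrow> nat \<Rightarrow> nat" where
  "diam_start n x = (if even x then x else x + n)"

definition shortest_arc :: "nat \<Rightarrow> nat \<Rightarrow> nat \<Rightarrow> nat ugraph" where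
  "shortest_arc n a b =
    (if b - a < n then arc (2 * n) a (b - a)
     else if b - a = n then arc (2 * n) (diam_start n a) n
     else arc (2 * n) b (2 * n - (b - a)))"

definition shortest_arcs :: "nat \<Rightarrow> nat ugraph set" where
  "shortest_arcs n = {shortest_arc n a b | a b. a < b \<and> b < 2 * n}"

lemma connects_shortest_arc:
  assumes "a < b" "b < 2 * n"
  shows "connects (cycle_graph (2 * n)) (shortest_arc n a b) a b"
proof -
  have connects_from: "connects (cycle_graph (2 * n)) (arc (2 * n) s l) s ((s + l) mod (2 * n))"
    if "s < 2 * n" "l < 2 * n" for s l
    using connects_arc[OF that(2), of s] that(1) by simp
  consider (forward) "b - a < n" | (antipodal) "b = a + n" | (backward) "n < b - a"
    using assms by linarith
  then show ?thesis
  proof cases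
    case forward
    then show ?thesis
      using connects_from[of a "b - a"] assms by (simp add: shortest_arc_def)
  next
    case antipodal
    then show ?thesis
      using connects_from[of a n] connects_sym[OF connects_from[of b n]] assms
      by (simp add: shortest_arc_def diam_start_def mod_if)
  next
    case backward
    then show ?thesis
      using connects_sym[OF connects_from[of b "2 * n - (b - a)"]] assms
      by (simp add: shortest_arc_def)
  qed
qed

lemma path_system_shortest_arcs: "path_system (cycle_graph (2 * n)) (shortest_arcs n)"
proof -
  have "shortest_arcs n = {shortest_arc n a b | a b.
      a \<in> verts (cycle_graph (2 * n)) \<and> b \<in> verts (cycle_graph (2 * n)) \<and> a < b}"
    by (auto simp: shortest_arcs_def verts_cycle_graph) (metis less_trans)
  then show ?thesis
    using path_system_of_ordered_pairs[of "cycle_graph (2 * n)" "shortest_arc n"]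
    by (simp add: connects_shortest_arc verts_cycle_graph)
qed

lemma shortest_arcs_cases:
  assumes "P \<in> shortest_arcs n"
  obtains (short) s l where "s < 2 * n" "0 < l" "l < n" "P = arc (2 * n) s l"
  | (diam) x where "x < n" "P = arc (2 * n) (diam_start n x) n"
proof -
  obtain a b where ends: "a < b" "b < 2 * n" "P = shortest_arc n a b"
    using assms by (auto simp: shortest_arcs_def)
  consider (forward) "b - a < n" | (antipodal) "b - a = n" | (backward) "n < b - a"
    by linarith
  then show thesis
  proof cases
    case forward
    then show thesis
      using ends by (intro short[of a "b - a"]) (auto simp: shortest_arc_def)
  next
    case antipodal
    then show thesis
      using ends by (intro diam[of a]) (auto simp: shortest_arc_def)
  next
    case backward
    then show thesis
      using ends by (intro short[of b "2 * n - (b - a)"]) (auto simp: shortest_arc_def)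
  qed
qed

section \<open>Packing the shortest paths\<close>

text \<open>The arc of length \<open>n - 1\<close> in \<open>unit_tiling\<close> is needed for odd \<open>n\<close> only.\<close>

definition unit_tiling :: "nat \<Rightarrow> nat ugraph set" where
  "unit_tiling n = tiling (2 * n) 0 (replicate (n - 1) 1 @ [n - 1, 1, 1])"

definition twin_tiling :: "nat \<Rightarrow> nat \<Rightarrow> nat ugraph set" where
  "twin_tiling n y = tiling (2 * n) (2 * y) [n - 1, 1, 1, n - 1]"

definition diam_tiling :: "nat \<Rightarrow> nat \<Rightarrow> nat ugraph set" where
  "diam_tiling n x = tiling (2 * n) (diam_start n x) [n, n - 1]"

definition alternating_tiling :: "nat \<Rightarrow> nat \<Rightarrow> nat \<Rightarrow> nat ugraph set" where
  "alternating_tiling n s l = tiling (2 * n) s [l, n - l, l, n - l]"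

definition packing_tilings :: "nat \<Rightarrow> nat ugraph set set" where
  "packing_tilings n = insert (unit_tiling n)
     (twin_tiling n ` {..<n div 2} \<union> diam_tiling n ` {..<n} \<union>
      (\<lambda>(s, l). alternating_tiling n s l) ` ({..<n} \<times> {2..n - 2}))"

lemma alternating_tiling_mod:
  assumes "l \<le> n"
  shows "alternating_tiling n (s mod n) l = alternating_tiling n s l"
  using tiling_double_mod[of "[l, n - l]" n s] assms by (simp add: alternating_tiling_def)

lemma alternating_tiling_swap:
  assumes "l \<le> n"
  shows "alternating_tiling n (s + l) (n - l) = alternating_tiling n s l"
  using tiling_rotate[of "[l]" "[n - l, l, n - l]" "2 * n" s] assms
  by (simp add: alternating_tiling_def)

lemma packing_tilingsI:
  shows "unit_tiling n \<in> packing_tilings n"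
    and "y < n div 2 \<Longrightarrow> twin_tiling n y \<in> packing_tilings n"
    and "x < n \<Longrightarrow> diam_tiling n x \<in> packing_tilings n"
    and "2 \<le> l \<Longrightarrow> l \<le> n - 2 \<Longrightarrow> alternating_tiling n s l \<in> packing_tilings n"
proof -
  show "alternating_tiling n s l \<in> packing_tilings n" if "2 \<le> l" "l \<le> n - 2"
  proof -
    have "alternating_tiling n s l = (\<lambda>(s, l). alternating_tiling n s l) (s mod n, l)"
      using that by (simp add: alternating_tiling_mod)
    moreover have "(s mod n, l) \<in> {..<n} \<times> {2..n - 2}"
      using that by simp
    ultimately show ?thesis
      unfolding packing_tilings_def by blast
  qed
qed (auto simp: packing_tilings_def)

lemma edge_disjoint_packing_tilings:
  assumes "2 \<le> n" "\<A> \<in> packing_tilings n"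
  shows "edge_disjoint \<A>"
proof -
  have "\<exists>s ls. \<A> = tiling (2 * n) s ls \<and> sum_list ls \<le> 2 * n"
    using assms unfolding packing_tilings_def unit_tiling_def twin_tiling_def diam_tiling_def
      alternating_tiling_def
    by (elim insertE UnE imageE) (fastforce simp: sum_list_replicate simp del: tiling.simps)+
  then show ?thesis
    using assms(1) edge_disjoint_tiling by auto
qed

lemma double_card_image_le:
  assumes "finite I" "\<And>i. i \<in> I \<Longrightarrow> \<exists>j\<in>I. j \<noteq> i \<and> f j = f i"
  shows "2 * card (f ` I) \<le> card I"
proof -
  have "2 \<le> card {i \<in> I. f i = y}" if "y \<in> f ` I" for y
  proof -
    obtain i j where "i \<in> I" "j \<in> I" "j \<noteq> i" "f i = y" "f j = y"
      using \<open>y \<in> f ` I\<close> assms(2) by blast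
    then have "card {i, j} \<le> card {i \<in> I. f i = y}"
      using assms(1) by (intro card_mono) auto
    then show ?thesis
      using \<open>j \<noteq> i\<close> by simp
  qed
  then have "(\<Sum>y\<in>f ` I. 2) \<le> (\<Sum>y\<in>f ` I. card {i \<in> I. f i = y})"
    by (rule sum_mono)
  also have "\<dots> = card I"
    using sum.image_gen[OF assms(1), of "\<lambda>_. 1::nat" f] by simp
  finally show ?thesis
    by simp
qed

lemma double_card_alternating_tilings_le:
  "2 * card ((\<lambda>(s, l). alternating_tiling n s l) ` ({..<n} \<times> {2..n - 2})) \<le> n * (n - 3)"
proof -
  have "2 * card ((\<lambda>(s, l). alternating_tiling n s l) ` ({..<n} \<times> {2..n - 2}))
      \<le> card ({..<n} \<times> {2..n - 2})"
  proof (rule double_card_image_le)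
    fix i assume "i \<in> {..<n} \<times> {2..n - 2}"
    then obtain s l where i: "i = (s, l)" and range: "s < n" "2 \<le> l" "l \<le> n - 2"
      by auto
    have "(s + l) mod n \<noteq> s"
      using range by (auto simp: mod_if)
    moreover have "alternating_tiling n ((s + l) mod n) (n - l) = alternating_tiling n s l"
      using range by (simp add: alternating_tiling_mod alternating_tiling_swap)
    ultimately show "\<exists>j\<in>{..<n} \<times> {2..n - 2}. j \<noteq> i \<and>
        (case j of (s, l) \<Rightarrow> alternating_tiling n s l) =
        (case i of (s, l) \<Rightarrow> alternating_tiling n s l)"
      using range by (intro bexI[of _ "((s + l) mod n, n - l)"]) (auto simp: i)
  qed simp
  then show ?thesis
    by (simp add: card_cartesian_product Suc_diff_le numeral_eq_Suc)
qed

lemma card_packing_tilings_le: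
  assumes "2 \<le> n"
  shows "card (packing_tilings n) \<le> (n choose 2) + n div 2 + 1"
proof (cases "n = 2")
  case True
  have "unit_tiling 2 = twin_tiling 2 0"
    by (simp add: unit_tiling_def twin_tiling_def)
  then have "packing_tilings n = insert (twin_tiling 2 0) (diam_tiling 2 ` {..<2})"
    using True by (auto simp: packing_tilings_def)
  then have "card (packing_tilings n) \<le> Suc (card (diam_tiling 2 ` {..<2}))"
    by (simp add: card_insert_le_m1)
  also have "\<dots> \<le> 3"
    using card_image_le[of "{..<2}" "diam_tiling 2"] by simp
  finally show ?thesis
    using True by (simp add: choose_two)
next
  case False
  let ?A = "(\<lambda>(s, l). alternating_tiling n s l) ` ({..<n} \<times> {2..n - 2})"
  let ?T = "twin_tiling n ` {..<n div 2}" and ?D = "diam_tiling n ` {..<n}"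
  have "n * (n - 3) + 3 * n = n * n"
    using assms False le_Suc_ex[of 3 n] by (auto simp: algebra_simps)
  then have "2 * card ?A + 2 * n \<le> 2 * (n choose 2)"
    using double_card_alternating_tilings_le[of n] double_choose_two[of n] by linarith
  moreover have "card ?T \<le> n div 2" "card ?D \<le> n"
    using card_image_le[of "{..<n div 2}" "twin_tiling n"] card_image_le[of "{..<n}" "diam_tiling n"]
    by simp_all
  moreover have "card (packing_tilings n) \<le> Suc (card (?T \<union> ?D \<union> ?A))"
    unfolding packing_tilings_def by (rule card_insert_le_m1) simp_all
  moreover have "card (?T \<union> ?D \<union> ?A) \<le> card ?T + card ?D + card ?A"
    by (intro order.trans[OF card_Un_le] add_right_mono card_Un_le)
  ultimately show ?thesis
    by linarith
qed

lemma unit_arc_covered: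
  assumes "2 \<le> n" "s < 2 * n"
  shows "arc (2 * n) s 1 \<in> \<Union>(packing_tilings n)"
proof -
  consider (low) "s < n - 1" | (middle) "n - 1 \<le> s" "s < 2 * n - 2"
    | (high) "s = 2 * n - 2 \<or> s = 2 * n - 1"
    using assms by linarith
  then show ?thesis
  proof cases
    case low
    then have "arc (2 * n) s 1 \<in> unit_tiling n"
      unfolding unit_tiling_def tiling_append tiling_units by simp
    then show ?thesis
      using packing_tilingsI(1) by blast
  next
    case high
    then have "s = n - 1 + (n - 1) \<or> s = n - 1 + (n - 1) + 1"
      using assms(1) by linarith
    then have "arc (2 * n) s 1 \<in> unit_tiling n"
      by (auto simp: unit_tiling_def tiling_append sum_list_replicate)
    then show ?thesis
      using packing_tilingsI(1) by blast
  next
    case middle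
    define y where "y = (s - (n - 1)) div 2"
    have "s - (n - 1) = 2 * y \<or> s - (n - 1) = 2 * y + 1"
      unfolding y_def by presburger
    then have "s = 2 * y + (n - 1) \<or> s = 2 * y + (n - 1) + 1"
      using middle by linarith
    then have "arc (2 * n) s 1 \<in> twin_tiling n y"
      by (auto simp: twin_tiling_def)
    moreover have "y < n div 2"
      using middle unfolding y_def by linarith
    ultimately show ?thesis
      using packing_tilingsI(2) by blast
  qed
qed

lemma diam_start_cases:
  assumes "s < 2 * n"
  obtains (antipodal) x where "x < n" "s mod (2 * n) = (diam_start n x + n) mod (2 * n)"
  | (even) y where "s = 2 * y" "2 * y < n"
  | (odd) y where "s = 2 * y + 1 + n" "2 * y + 1 < n"
proof -
  define x where "x = s mod n"
  have residue: "x < n" "s = x \<or> s = x + n"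
    using assms by (auto simp: x_def mod_if)
  consider (even_low) "even x" "s = x" | (even_high) "even x" "s = x + n"
    | (odd_low) "odd x" "s = x" | (odd_high) "odd x" "s = x + n"
    using residue(2) by blast
  then show thesis
  proof cases
    case even_low
    then show thesis
      using residue(1) by (auto intro: even elim!: evenE)
  next
    case even_high
    then show thesis
      using residue(1) antipodal by (simp add: diam_start_def)
  next
    case odd_low
    then have "diam_start n x + n = s + 2 * n"
      by (simp add: diam_start_def)
    then show thesis
      using residue(1) antipodal mod_add_self2 by metis
  next
    case odd_high
    then show thesis
      using residue(1) by (auto intro: odd elim!: oddE)
  qed
qed

lemma long_arc_covered:
  assumes "2 \<le> n" "s < 2 * n"
  shows "arc (2 * n) s (n - 1) \<in> \<Union>(packing_tilings n)"
  using assms(2)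
proof (cases rule: diam_start_cases)
  case (antipodal x)
  then have "arc (2 * n) s (n - 1) \<in> diam_tiling n x"
    using arc_cong[of s "2 * n" "diam_start n x + n" "n - 1"] by (simp add: diam_tiling_def)
  then show ?thesis
    using antipodal packing_tilingsI(3) by blast
next
  case (even y)
  show ?thesis
  proof (cases "y < n div 2")
    case True
    have "arc (2 * n) s (n - 1) \<in> twin_tiling n y"
      by (simp add: twin_tiling_def even)
    then show ?thesis
      using True packing_tilingsI(2) by blast
  next
    case False
    then have "s = n - 1"
      using even by linarith
    then have "arc (2 * n) s (n - 1) \<in> unit_tiling n"
      by (simp add: unit_tiling_def tiling_append sum_list_replicate)
    then show ?thesis
      using packing_tilingsI(1) by blast
  qed
next
  case (odd y)
  have "s = 2 * y + (n - 1) + 1 + 1"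
    using odd assms(1) by simp
  then have "arc (2 * n) s (n - 1) \<in> twin_tiling n y"
    unfolding twin_tiling_def by simp
  moreover have "y < n div 2"
    using odd by linarith
  ultimately show ?thesis
    using packing_tilingsI(2) by blast
qed

lemma shortest_arcs_covered:
  assumes "2 \<le> n"
  shows "shortest_arcs n \<subseteq> \<Union>(packing_tilings n)"
proof
  fix P assume "P \<in> shortest_arcs n"
  then show "P \<in> \<Union>(packing_tilings n)"
  proof (cases rule: shortest_arcs_cases)
    case (short s l)
    consider (unit) "l = 1" | (long) "l = n - 1" | (medium) "2 \<le> l" "l \<le> n - 2"
      using short by linarith
    then show ?thesis
    proof cases
      case medium
      have "P \<in> alternating_tiling n s l"
        unfolding alternating_tiling_def short(4) by simp
      then show ?thesis
        using medium packing_tilingsI(4) by blast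
    qed (use short assms unit_arc_covered long_arc_covered in simp_all)
  next
    case (diam x)
    then have "P \<in> diam_tiling n x"
      by (simp add: diam_tiling_def)
    then show ?thesis
      using diam packing_tilingsI(3) by blast
  qed
qed

lemma ex_global_packing_shortest_arcs:
  assumes "1 \<le> n"
  shows "\<exists>\<omega>. global_packing (shortest_arcs n) ((n choose 2) + n div 2 + 1) \<omega>"
proof (cases "n = 1")
  case True
  have "shortest_arcs n \<subseteq> \<Union>{{shortest_arc 1 0 1}}"
    by (auto simp: shortest_arcs_def True less_Suc_eq numeral_2_eq_2)
  then show ?thesis
    by (rule global_packing_of_cover[rotated 3]) (simp_all add: edge_disjoint_singleton)
next
  case False
  then have "2 \<le> n"
    using assms by simp
  have "finite (packing_tilings n)"
    by (simp add: packing_tilings_def)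
  then show ?thesis
    using card_packing_tilings_le[OF \<open>2 \<le> n\<close>] edge_disjoint_packing_tilings[OF \<open>2 \<le> n\<close>]
      shortest_arcs_covered[OF \<open>2 \<le> n\<close>]
    by (rule global_packing_of_cover)
qed

theorem theorem1:
  fixes n :: nat
  assumes "n \<ge> 1"
  shows "Phi (cycle_graph (2 * n)) = (n choose 2) + n div 2 + 1"
proof -
  obtain \<omega> where packing: "global_packing (shortest_arcs n) ((n choose 2) + n div 2 + 1) \<omega>"
    using ex_global_packing_shortest_arcs[OF assms] ..
  show ?thesis
  proof (rule Phi_eqI[OF _ path_system_shortest_arcs packing])
    show "finite (verts (cycle_graph (2 * n)))"
      by (simp add: verts_cycle_graph)
  qed (rule cycle_packing_lower_bound[OF assms])
qed

end
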